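(* For every $n\ge1$, the set $\mathbb{YFT}_n$ of standard Young-Fibonacci tableaux of size $n$, equipped with the relation $\preceq$, is a graded poset, the rank of a tableau $t$ being the number of inversions of its minimal canonical permutation $w_{min}^{t}$.
   Context: **Tableaux.** A snakeshape of size $n$ is a word $u=u_1\cdots u_k$ with letters in $\{1,2\}$ and sum $n$, drawn as $k$ bottom-justified columns from left to right, the $i$-th column having $u_i$ boxes; in a single-boxed column the unique box is both bottom and top box. A standard Young-Fibonacci tableau of size $n$ is a numbering of a snakeshape of size $n$ with $1,\dots,n$ (each used once) such that in each two-boxed column the top entry is larger than the bottom entry, and the entry in the top box of any column is larger than all entries in the columns to its right. $\mathbb{YFT}_n$ is the set of these. **Shifting an entry.** Let $a$ be the bottom entry of a column of $t$ which is not the first column; let $b$ be the entry on top of $a$, if the column of $a$ is two-boxed. A shift of $a$ is possible in the following cases and modifies only the column of $a$ and the column just to its left. (1) The column just to the left of $a$ is single-boxed with entry $c$. Then these columns are replaced by a two-boxed column with bottom $a$ and top $c$, followed (if $b$ exists) by a single-boxed column $b$. (2) The column just to the left of $a$ is two-boxed with bottom $c$ and top $d$, and $a<c$. If $b$ exists and $c<b$, the two columns are replaced by the two-boxed column (bottom $a$, top $d$) followed by the two-boxed column (bottom $c$, top $b$). Otherwise they are replaced by the two-boxed column (bottom $a$, top $d$), followed by a single-boxed column $c$, followed (if $b$ exists) by a single-boxed column $b$. The result is again a standard Young-Fibonacci tableau of size $n$. **Order.** $t\preceq t'$ if there is a sequence $t_0=t,t_1,\dots,t_k=t'$ ($k\ge0$)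 in $\mathbb{YFT}_n$ such that $t_{i+1}$ is obtained from $t_i$ by shifting an entry, for $0\le i\le k-1$. **Minimal canonical permutation.** $w_{min}^{t}$ is the word obtained by reading the columns of $t$ from right to left, each column being read from top to bottom. An inversion of a permutation $\sigma$ is a couple $(j,i)$ with $1\le i<j\le n$ such that $j$ appears to the left of $i$ in the word $\sigma$. "Graded" means that the rank increases by exactly $1$ along every covering relation. *)

theory Defs
  imports Main
begin

text \<open>A column is either single-boxed, or two-boxed with \<open>Double a b\<close> having bottom entry \<open>a\<close>
  and top entry \<open>b\<close>. A numbered snakeshape is the list of its columns from left to right.\<close>

datatype column = Single nat | Double nat nat

type_synonym numbering = "column list"

fun height :: "column \<Rightarrow> nat" where
  "height (Single a) = 1"
| "height (Double a b) = 2"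

fun top_entry :: "column \<Rightarrow> nat" where
  "top_entry (Single a) = a"
| "top_entry (Double a b) = b"

fun column_word :: "column \<Rightarrow> nat list" where
  "column_word (Single a) = [a]"
| "column_word (Double a b) = [b, a]"

definition snakeshape :: "nat \<Rightarrow> nat list \<Rightarrow> bool" where
  "snakeshape n u \<longleftrightarrow> set u \<subseteq> {1, 2} \<and> sum_list u = n"

definition entries :: "numbering \<Rightarrow> nat list" where
  "entries t = concat (map column_word t)"

definition YFT :: "nat \<Rightarrow> numbering set" where
  "YFT n = {t. snakeshape n (map height t)
     \<and> distinct (entries t) \<and> set (entries t) = {1..n}
     \<and> (\<forall>a b. Double a b \<in> set t \<longrightarrow> a < b)
     \<and> (\<forall>i j. i < j \<and> j < length t \<longrightarrow>
          (\<forall>x \<in> set (column_word (t ! j)). x < top_entry (t ! i)))}"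

text \<open>\<open>shift t t'\<close>: \<open>t'\<close> is obtained from \<open>t\<close> by shifting the entry called \<open>a\<close>. The columns
  in \<open>p\<close> (to the left) and \<open>q\<close> (to the right) are not modified.\<close>

inductive shift :: "numbering \<Rightarrow> numbering \<Rightarrow> bool" where
  single_single:
    "shift (p @ [Single c, Single a] @ q) (p @ [Double a c] @ q)"
| single_double:
    "shift (p @ [Single c, Double a b] @ q) (p @ [Double a c, Single b] @ q)"
| double_single:
    "a < c \<Longrightarrow>
     shift (p @ [Double c d, Single a] @ q) (p @ [Double a d, Single c] @ q)"
| double_double_less:
    "a < c \<Longrightarrow> c < b \<Longrightarrow>
     shift (p @ [Double c d, Double a b] @ q) (p @ [Double a d, Double c b] @ q)"
| double_double_not_less:
    "a < c \<Longrightarrow> \<not> c < b \<Longrightarrow>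
     shift (p @ [Double c d, Double a b] @ q) (p @ [Double a d, Single c, Single b] @ q)"

definition YFT_order :: "nat \<Rightarrow> (numbering \<times> numbering) set" where
  "YFT_order n =
     {(t, t'). shift t t' \<and> t \<in> YFT n \<and> t' \<in> YFT n}\<^sup>* \<inter> (YFT n \<times> YFT n)"

definition w_min :: "numbering \<Rightarrow> nat list" where
  "w_min t = concat (map column_word (rev t))"

text \<open>Inversions are pairs of values (the larger one first), not of positions.\<close>

definition inversions :: "nat list \<Rightarrow> (nat \<times> nat) set" where
  "inversions w = {(j, i). 1 \<le> i \<and> i < j \<and> j \<le> length w
     \<and> (\<exists>k l. k < l \<and> l < length w \<and> w ! k = j \<and> w ! l = i)}"

definition covered_by :: "'a set \<Rightarrow> ('a \<times> 'a) set \<Rightarrow> 'a \<Rightarrow> 'a \<Rightarrow> bool" where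
  "covered_by A r x y \<longleftrightarrow> x \<in> A \<and> y \<in> A \<and> (x, y) \<in> r \<and> x \<noteq> y
     \<and> \<not> (\<exists>z \<in> A. z \<noteq> x \<and> z \<noteq> y \<and> (x, z) \<in> r \<and> (z, y) \<in> r)"

definition graded_poset :: "'a set \<Rightarrow> ('a \<times> 'a) set \<Rightarrow> ('a \<Rightarrow> nat) \<Rightarrow> bool" where
  "graded_poset A r rank \<longleftrightarrow> partial_order_on A r
     \<and> (\<forall>x y. covered_by A r x y \<longrightarrow> rank y = rank x + 1)"

end

theory Submission
  imports Defs "HOL-Library.Multiset"
begin

text \<open>Every shift of a tableau creates exactly one new inversion of the minimal canonical
  permutation, since it only rearranges the word of two adjacent columns: \<open>a c\<close> becomes \<open>c a\<close>,
  \<open>b a c\<close> becomes \<open>b c a\<close>, \<open>a d c\<close> becomes \<open>c d a\<close>, and \<open>b a d c\<close> becomes \<open>b c d a\<close>, where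
  \<open>a < c < d\<close>. So the order is antisymmetric, and its covering relations are single shifts.\<close>

text \<open>Each inversion is counted at its larger, left entry. The recursion lets the simplifier
  evaluate the count on words of two to four letters and split it over appends.\<close>

fun inv_count :: "nat list \<Rightarrow> nat" where
  "inv_count [] = 0"
| "inv_count (x # xs) = length (filter (\<lambda>y. y < x) xs) + inv_count xs"

text \<open>The value bounds of \<open>inversions\<close> are left out, since the tail of a
  permutation of an initial segment need not be one and the induction would break.\<close>

lemma card_inversions_distinct:
  assumes "distinct w"
  shows "card {(j, i). i < j \<and> (\<exists>k l. k < l \<and> l < length w \<and> w ! k = j \<and> w ! l = i)}
    = inv_count w"
  using assms
proof (induction w)
  case Nil
  then show ?case by simp
next
  case (Cons x xs)
  let ?I = "\<lambda>w :: nat list. {(j, i). i < j \<and> (\<exists>k l. k < l \<and> l < length w \<and> w ! k = j \<and> w ! l = i)}"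
  have split: "?I (x # xs) = {x} \<times> {y \<in> set xs. y < x} \<union> ?I xs"
  proof (intro equalityI subsetI)
    fix z assume "z \<in> ?I (x # xs)"
    then obtain k l where kl: "k < l" "l < Suc (length xs)"
      and z: "z = ((x # xs) ! k, (x # xs) ! l)" "(x # xs) ! l < (x # xs) ! k"
      by auto
    \<comment> \<open>As \<open>k < l\<close>, the smaller letter lies in \<open>xs\<close>; whether
      \<open>k\<close> is zero decides which part of the union contains the pair.\<close>
    from kl obtain l' where l: "l = Suc l'" by (cases l) auto
    show "z \<in> {x} \<times> {y \<in> set xs. y < x} \<union> ?I xs"
      by (cases k) (use kl z l in auto)
  next
    fix z assume "z \<in> {x} \<times> {y \<in> set xs. y < x} \<union> ?I xs"
    then consider l where "l < length xs" "z = (x, xs ! l)" "xs ! l < x"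
      | k l where "k < l" "l < length xs" "z = (xs ! k, xs ! l)" "xs ! l < xs ! k"
      by (auto simp: in_set_conv_nth)
    then show "z \<in> ?I (x # xs)"
    proof cases
      case (1 l)
      then have "0 < Suc l \<and> Suc l < length (x # xs) \<and> (x # xs) ! 0 = x \<and> (x # xs) ! Suc l = xs ! l"
        by simp
      with 1 show ?thesis by blast
    next
      case (2 k l)
      then have "Suc k < Suc l \<and> Suc l < length (x # xs)
          \<and> (x # xs) ! Suc k = xs ! k \<and> (x # xs) ! Suc l = xs ! l"
        by simp
      with 2 show ?thesis by blast
    qed
  qed
  have sub: "?I xs \<subseteq> set xs \<times> set xs" by auto
  then have "finite (?I xs)" by (rule finite_subset) simp
  moreover have "({x} \<times> {y \<in> set xs. y < x}) \<inter> ?I xs = {}"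
    using sub Cons.prems by auto
  moreover have "card {y \<in> set xs. y < x} = length (filter (\<lambda>y. y < x) xs)"
    using Cons.prems distinct_card[of "filter (\<lambda>y. y < x) xs"] by simp
  ultimately show ?case
    unfolding split using Cons by (simp add: card_Un_disjoint card_cartesian_product)
qed

lemma card_inversions:
  assumes "distinct w" "set w = {1..n}"
  shows "card (inversions w) = inv_count w"
proof -
  have "length w = n"
    using distinct_card[OF assms(1)] assms(2) by simp
  moreover have "1 \<le> w ! k \<and> w ! k \<le> n" if "k < length w" for k
    using nth_mem[OF that] assms(2) by simp
  ultimately have "inversions w
      = {(j, i). i < j \<and> (\<exists>k l. k < l \<and> l < length w \<and> w ! k = j \<and> w ! l = i)}"
    unfolding inversions_def by fastforce
  then show ?thesis
    using card_inversions_distinct[OF assms(1)] by simp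
qed

lemma length_filter_cong_mset:
  "mset xs = mset ys \<Longrightarrow> length (filter P xs) = length (filter P ys)"
  by (metis mset_filter size_mset)

lemma inv_count_append:
  "inv_count (xs @ ys)
    = inv_count xs + inv_count ys + (\<Sum>x\<in>#mset xs. length (filter (\<lambda>y. y < x) ys))"
  by (induction xs) auto

text \<open>Inversions between the infix and the rest depend only on the multiset of the infix. The
  additive form avoids truncated subtraction.\<close>

lemma inv_count_replace_infix:
  assumes "mset ys = mset ys'"
  shows "inv_count (xs @ ys @ zs) + inv_count ys' = inv_count (xs @ ys' @ zs) + inv_count ys"
  using assms length_filter_cong_mset[OF assms] by (simp add: inv_count_append)

lemma w_min_infix: "w_min (p @ s @ q) = w_min q @ w_min s @ w_min p"
  by (simp add: w_min_def)

lemma YFT_w_min: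
  assumes "t \<in> YFT n"
  shows "distinct (w_min t)" "set (w_min t) = {1..n}"
proof -
  have "mset (w_min t) = mset (entries t)"
    unfolding w_min_def entries_def by (induction t) auto
  then have "distinct (w_min t) = distinct (entries t)" "set (w_min t) = set (entries t)"
    by (rule mset_eq_imp_distinct_iff, rule mset_eq_setD)
  then show "distinct (w_min t)" "set (w_min t) = {1..n}"
    using assms unfolding YFT_def by auto
qed

lemma YFT_adjacent_less:
  assumes "p @ x # y # q \<in> YFT n" "e \<in> set (column_word y)"
  shows "e < top_entry x"
proof -
  let ?t = "p @ x # y # q"
  have "\<forall>i j. i < j \<and> j < length ?t \<longrightarrow> (\<forall>e \<in> set (column_word (?t ! j)). e < top_entry (?t ! i))"
    using assms(1) unfolding YFT_def by blast
  from this[rule_format, of "length p" "Suc (length p)"] show ?thesis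
    using assms(2) by (simp add: nth_append)
qed

lemma YFT_Double_less: "t \<in> YFT n \<Longrightarrow> Double a b \<in> set t \<Longrightarrow> a < b"
  unfolding YFT_def by blast

lemma inv_count_shift:
  assumes "shift t t'" "t \<in> YFT n"
  shows "inv_count (w_min t') = Suc (inv_count (w_min t))"
proof -
  \<comment> \<open>It is thus enough to compare the short words of the columns that the shift
    replaces.\<close>
  have *: "inv_count (w_min (p @ s' @ q)) = Suc (inv_count (w_min (p @ s @ q)))"
    if "mset (w_min s) = mset (w_min s')" "inv_count (w_min s') = Suc (inv_count (w_min s))"
    for p s s' q
    using inv_count_replace_infix[OF that(1), of "w_min q" "w_min p"] that(2)
    by (simp add: w_min_infix)
  show ?thesis
    using assms
  proof cases
    case (single_single p c a q)
    \<comment> \<open>A single-boxed left neighbour has \<open>c\<close> in its top box, so the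
      tableau condition gives \<open>a < c\<close>. For a two-boxed one, \<open>a < c\<close> is a
      premise of the shift and the column gives \<open>c < d\<close>.\<close>
    then have "a < c" using assms(2) YFT_adjacent_less[of p _ _ q n a] by fastforce
    then show ?thesis unfolding single_single by (intro *) (simp_all add: w_min_def)
  next
    case (single_double p c a b q)
    then have "a < c" using assms(2) YFT_adjacent_less[of p _ _ q n a] by fastforce
    then show ?thesis unfolding single_double by (intro *) (simp_all add: w_min_def)
  next
    case (double_single a c p d q)
    then have "c < d" using YFT_Double_less[OF assms(2)] by simp
    then show ?thesis
      unfolding double_single using \<open>a < c\<close> by (intro *) (simp_all add: w_min_def)
  next
    case (double_double_less a c b p d q)
    then have "c < d" using YFT_Double_less[OF assms(2)] by simp
    then show ?thesis
      unfolding double_double_less using \<open>a < c\<close> by (intro *) (simp_all add: w_min_def)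
  next
    \<comment> \<open>Comparing \<open>c\<close> with \<open>b\<close> affects only the shape:
      \<open>b\<close> stays in front of the same three letters, so the count is as in the previous
      case.\<close>
    case (double_double_not_less a c b p d q)
    then have "c < d" using YFT_Double_less[OF assms(2)] by simp
    then show ?thesis
      unfolding double_double_not_less using \<open>a < c\<close> by (intro *) (simp_all add: w_min_def)
  qed
qed

lemma graded_poset_rtrancl:
  fixes rank :: "'a \<Rightarrow> nat"
  assumes step: "\<And>x y. (x, y) \<in> R \<Longrightarrow> x \<in> A \<and> y \<in> A \<and> rank y = Suc (rank x)"
  shows "graded_poset A (R\<^sup>* \<inter> A \<times> A) rank"
proof -
  have mono: "x = y \<or> rank x < rank y" if "(x, y) \<in> R\<^sup>*" for x y
    using that by (induction rule: rtrancl_induct) (auto dest: step)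
  have antisym: "x = y" if "(x, y) \<in> R\<^sup>*" "(y, x) \<in> R\<^sup>*" for x y
    using mono[OF that(1)] mono[OF that(2)] by auto
  have "partial_order_on A (R\<^sup>* \<inter> A \<times> A)"
    unfolding partial_order_on_def preorder_on_def
    by (auto intro!: refl_onI transI antisymI antisym)
  moreover have "rank y = rank x + 1" if cov: "covered_by A (R\<^sup>* \<inter> A \<times> A) x y" for x y
  proof -
    from cov have "(x, y) \<in> R\<^sup>*" "x \<noteq> y" unfolding covered_by_def by auto
    \<comment> \<open>The first step of a path from \<open>x\<close> to \<open>y\<close> raises the
      rank, so \<open>z\<close> differs from \<open>x\<close>; were it also different from
      \<open>y\<close>, it would lie strictly between them.\<close>
    then obtain z where z: "(x, z) \<in> R" "(z, y) \<in> R\<^sup>*"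
      by (meson converse_rtranclE)
    then have "z = y"
      using cov step[OF z(1)] unfolding covered_by_def by auto
    then show ?thesis using step[OF z(1)] by simp
  qed
  ultimately show ?thesis unfolding graded_poset_def by blast
qed

theorem proposition5p5:
  fixes n :: nat
  assumes "n \<ge> 1"
  shows "graded_poset (YFT n) (YFT_order n) (\<lambda>t. card (inversions (w_min t)))"
  unfolding YFT_order_def
  by (rule graded_poset_rtrancl)
    (auto simp: card_inversions[OF YFT_w_min] inv_count_shift)

end
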